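(* Let $v\leq w$ be positive integers with $v$ odd. If $w$ is even, then $\operatorname{HDE}(P_v;P_w)=\frac{v+1}{w+2}$. If $w$ is odd, then $\operatorname{HDE}(P_v;P_w)=\frac{k(v+1)-v}{kw+2k-w-1}$, where $k$ is the smallest integer such that $k(v+1)\geq w+1$.
   Context: All graphs are finite and simple; $P_k$ denotes the path with $k$ edges ($k+1$ vertices). $\operatorname{hom}(F;G)$ is the number of graph homomorphisms from $F$ to $G$. The homomorphism domination exponent $\operatorname{HDE}(F_1;F_2)$ is the maximum value of $c$ such that $\operatorname{hom}(F_1;G)\geq\operatorname{hom}(F_2;G)^c$ for every graph $G$. *)

theory Defs
  imports
    "HOL-Analysis.Analysis"
    "HOL-Library.FuncSet"
    "Graph_Theory.Pair_Digraph"
begin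

text \<open>
  A finite simple graph is a \<open>pair_graph\<close>: a finite vertex set with a symmetric irreflexive set of
  arcs on it, so that each undirected edge is represented by its two orientations.
\<close>

text \<open>The functions are taken extensional, so that each homomorphism is counted once.\<close>

definition hom_set :: "'a pair_pre_digraph \<Rightarrow> 'b pair_pre_digraph \<Rightarrow> ('a \<Rightarrow> 'b) set" where
  "hom_set F G =
    {f \<in> pverts F \<rightarrow>\<^sub>E pverts G. \<forall>x y. (x, y) \<in> parcs F \<longrightarrow> (f x, f y) \<in> parcs G}"

definition hom :: "'a pair_pre_digraph \<Rightarrow> 'b pair_pre_digraph \<Rightarrow> nat" where
  "hom F G = card (hom_set F G)"

text \<open>The path with \<open>k\<close> edges, hence with \<open>k + 1\<close> vertices.\<close>

definition path_graph :: "nat \<Rightarrow> nat pair_pre_digraph" where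
  "path_graph k =
    \<lparr> pverts = {0..k},
      parcs = {(i, j). i \<le> k \<and> j \<le> k \<and> (j = Suc i \<or> i = Suc j)} \<rparr>"

lemma pair_graph_path_graph: "pair_graph (path_graph k)"
proof -
  have "finite {(i, j). i \<le> k \<and> j \<le> k \<and> (j = Suc i \<or> i = Suc j)}"
    by (rule finite_subset[of _ "{0..k} \<times> {0..k}"]) auto
  then show ?thesis
    by unfold_locales (auto simp: path_graph_def symmetric_def intro!: symI)
qed

text \<open>
  The graph \<open>G\<close> ranges over the finite simple graphs with vertices in \<open>nat\<close>, that is, over all
  finite simple graphs up to isomorphism; see \<open>hom_dominatesD\<close> below. When \<open>hom F\<^sub>2 G = 0\<close> the
  power is \<open>0 powr c = 0\<close>, the usual value for \<open>c > 0\<close>.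
\<close>

definition hom_dominates ::
  "'a pair_pre_digraph \<Rightarrow> 'b pair_pre_digraph \<Rightarrow> real \<Rightarrow> bool" where
  "hom_dominates F\<^sub>1 F\<^sub>2 c \<longleftrightarrow>
    (\<forall>G :: nat pair_pre_digraph. pair_graph G \<longrightarrow> real (hom F\<^sub>1 G) \<ge> real (hom F\<^sub>2 G) powr c)"

text \<open>
  \<open>is_HDE F\<^sub>1 F\<^sub>2 c\<close> means that the maximum defining the homomorphism domination exponent of
  \<open>F\<^sub>1\<close> and \<open>F\<^sub>2\<close> exists and equals \<open>c\<close>. A relation is used because a maximum need not exist in
  general.
\<close>

definition is_HDE :: "'a pair_pre_digraph \<Rightarrow> 'b pair_pre_digraph \<Rightarrow> real \<Rightarrow> bool" where
  "is_HDE F\<^sub>1 F\<^sub>2 c \<longleftrightarrow>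
    hom_dominates F\<^sub>1 F\<^sub>2 c \<and> (\<forall>c'. hom_dominates F\<^sub>1 F\<^sub>2 c' \<longrightarrow> c' \<le> c)"

lemma is_HDE_unique: "is_HDE F\<^sub>1 F\<^sub>2 c \<Longrightarrow> is_HDE F\<^sub>1 F\<^sub>2 d \<Longrightarrow> c = d"
  by (auto simp: is_HDE_def intro: antisym)

definition map_graph :: "('b \<Rightarrow> 'c) \<Rightarrow> 'b pair_pre_digraph \<Rightarrow> 'c pair_pre_digraph" where
  "map_graph g G = \<lparr> pverts = g ` pverts G, parcs = map_prod g g ` parcs G \<rparr>"

lemma pair_graph_map_graph:
  assumes "pair_graph G" "inj_on g (pverts G)"
  shows "pair_graph (map_graph g G)"
proof -
  interpret pair_graph G by fact
  have S: "(y, x) \<in> parcs G" if "(x, y) \<in> parcs G" for x y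
    using pair_sym_arcs that by (auto simp: symmetric_def dest: symD)
  show ?thesis
  proof (unfold_locales, goal_cases)
    case (5 e)
    then obtain x y where xy: "(x, y) \<in> parcs G" "e = (g x, g y)"
      by (auto simp: map_graph_def)
    moreover have "x \<in> pverts G" "y \<in> pverts G" "x \<noteq> y"
      using in_arcsD1 in_arcsD2 xy(1) pair_no_loops by force+
    ultimately show ?case
      using assms(2) by (auto dest: inj_onD)
  next
    case 6
    show ?case
      unfolding symmetric_def with_proj_simps
    proof (rule symI)
      fix a b assume "(a, b) \<in> parcs (map_graph g G)"
      then obtain x y where "(x, y) \<in> parcs G" "a = g x" "b = g y"
        by (auto simp: map_graph_def)
      then show "(b, a) \<in> parcs (map_graph g G)"
        using S by (force simp: map_graph_def)
    qed
  qed (auto simp: map_graph_def in_arcsD1 in_arcsD2 pair_finite_verts pair_finite_arcs)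
qed

lemma hom_map_graph:
  assumes F: "pair_graph F" and G: "pair_graph G" and inj: "inj_on g (pverts G)"
  shows "hom F (map_graph g G) = hom F G"
proof -
  interpret F: pair_graph F by fact
  interpret G: pair_graph G by fact
  let ?h = "inv_into (pverts G) g"
  have h: "?h (g x) = x" if "x \<in> pverts G" for x
    using that inj by simp
  have "bij_betw (\<lambda>f. restrict (g \<circ> f) (pverts F)) (hom_set F G) (hom_set F (map_graph g G))"
  proof (rule bij_betw_byWitness[where f' = "\<lambda>f. restrict (?h \<circ> f) (pverts F)"])
    show "\<forall>f\<in>hom_set F G. restrict (?h \<circ> restrict (g \<circ> f) (pverts F)) (pverts F) = f"
      using h by (auto simp: hom_set_def fun_eq_iff restrict_def PiE_iff extensional_def)
    show "\<forall>f\<in>hom_set F (map_graph g G).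
        restrict (g \<circ> restrict (?h \<circ> f) (pverts F)) (pverts F) = f"
      by (auto simp: hom_set_def map_graph_def fun_eq_iff restrict_def PiE_iff extensional_def
          intro!: f_inv_into_f)
    show "(\<lambda>f. restrict (g \<circ> f) (pverts F)) ` hom_set F G \<subseteq> hom_set F (map_graph g G)"
      using F.in_arcsD1 F.in_arcsD2 by (fastforce simp: hom_set_def map_graph_def)
    show "(\<lambda>f. restrict (?h \<circ> f) (pverts F)) ` hom_set F (map_graph g G) \<subseteq> hom_set F G"
    proof (rule image_subsetI)
      fix f assume f: "f \<in> hom_set F (map_graph g G)"
      have "?h (f x) \<in> pverts G" if "x \<in> pverts F" for x
        using f that by (auto simp: hom_set_def map_graph_def intro!: inv_into_into)
      moreover have "(?h (f x), ?h (f y)) \<in> parcs G" if xy: "(x, y) \<in> parcs F" for x y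
      proof -
        have "(f x, f y) \<in> map_prod g g ` parcs G"
          using f xy by (auto simp: hom_set_def map_graph_def)
        then obtain a b where "(a, b) \<in> parcs G" "f x = g a" "f y = g b"
          by auto
        then show ?thesis
          using h G.in_arcsD1 G.in_arcsD2 by auto
      qed
      ultimately show "restrict (?h \<circ> f) (pverts F) \<in> hom_set F G"
        using F.in_arcsD1 F.in_arcsD2 by (auto simp: hom_set_def)
    qed
  qed
  then show ?thesis
    by (simp add: hom_def bij_betw_same_card)
qed

lemma hom_dominatesD:
  fixes G :: "'c pair_pre_digraph"
  assumes "pair_graph F\<^sub>1" "pair_graph F\<^sub>2" "hom_dominates F\<^sub>1 F\<^sub>2 c" "pair_graph G"
  shows "real (hom F\<^sub>1 G) \<ge> real (hom F\<^sub>2 G) powr c"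
proof -
  interpret pair_graph G by fact
  obtain g :: "'c \<Rightarrow> nat" where g: "inj_on g (pverts G)"
    using finite_imp_inj_to_nat_seg[OF pair_finite_verts] by blast
  show ?thesis
    using assms pair_graph_map_graph[OF assms(4) g] g
    by (metis hom_dominates_def hom_map_graph)
qed

end

theory Submission
  imports Defs
begin

text \<open>
  Lower bound. Write \<open>a n\<close> for the number of homomorphisms from the path with \<open>n\<close> edges to \<open>G\<close>. Let
  \<open>X\<^sub>0, \<dots>, X\<^sub>w\<close> be a uniformly random walk with \<open>w\<close> edges, let \<open>h j\<close> be the entropy of \<open>X\<^sub>j\<close>, and let
  the gain of a step between \<open>i\<close> and \<open>j = i + 1\<close> be \<open>H(X\<^sub>i, X\<^sub>j) - (h i + h j) / 2\<close>. A walk \<open>\<phi>\<close> of \<open>n\<close>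
  steps on the indices \<open>0, \<dots>, w\<close> gives a Markov chain in \<open>G\<close>, whence \<open>ln (a n)\<close> is at least
  \<open>(h (\<phi> 0) + h (\<phi> n)) / 2\<close> plus the gains of the steps of \<open>\<phi>\<close>; this is an equality for the identity
  and \<open>n = w\<close>. Let \<open>\<beta>\<close> be the largest gain. Inserting bounces on a step of gain \<open>\<beta>\<close> yields
  \<open>ln (a w) + 2 m \<beta> \<le> ln (a (w + 2 m))\<close>, and going \<open>0, 1, \<dots>, q, q - 1, \<dots>, 1\<close> with \<open>2 q = v + 1\<close>, at
  both ends of the random walk, yields \<open>ln (a w) \<le> ln (a v) + (w - v + 1) \<beta>\<close>. Cutting walks into
  pieces gives \<open>a (k (v + 1) - 1) \<le> (a v) ^ k\<close>, and eliminating \<open>\<beta>\<close> gives both exponents.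

  Upper bound. In a graph with layers \<open>0, \<dots>, w\<close>, where layer \<open>i\<close> has \<open>n ^ h i\<close> vertices and each
  vertex of layer \<open>i\<close> has \<open>n\<close> to the power \<open>K + (h j - h i) / 2\<close> neighbours in each adjacent layer \<open>j\<close>,
  the number of walks of \<open>m\<close> steps from layer \<open>i\<close> to layer \<open>j\<close> is of order \<open>n\<close> to the power
  \<open>K m + (h i + h j) / 2\<close>. So \<open>h\<close> is to be large at \<open>0\<close> and \<open>w\<close>, but with a small sum at any two
  layers joined by a walk of \<open>v\<close> steps.
\<close>

section \<open>Walk counts\<close>

text \<open>The log sum inequality follows from \<open>ln t \<le> t - 1\<close> at the ratio of the
  normalized weights. The last assumption excludes terms in which the convention
  \<open>ln 0 = 0\<close> would break it.\<close>

lemma log_sum_ineq: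
  fixes p f :: "'a \<Rightarrow> real"
  assumes "finite A" "\<And>x. x \<in> A \<Longrightarrow> 0 \<le> p x" "\<And>x. x \<in> A \<Longrightarrow> 0 \<le> f x"
    and "\<And>x. x \<in> A \<Longrightarrow> 0 < p x \<Longrightarrow> 0 < f x"
  shows "(\<Sum>x\<in>A. p x * (ln (f x) - ln (p x))) \<le> sum p A * (ln (sum f A) - ln (sum p A))"
proof (cases "sum p A = 0")
  case True
  then have "p x = 0" if "x \<in> A" for x
    using that assms by (simp add: sum_nonneg_eq_0_iff)
  then show ?thesis by (simp add: True)
next
  case False
  then have P: "0 < sum p A"
    using assms(2) by (simp add: order_le_neq_trans sum_nonneg)
  obtain x0 where "x0 \<in> A" "0 < p x0"
    using False assms(2) by (metis less_eq_real_def sum.neutral)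
  then have F: "0 < sum f A"
    using assms by (metis sum_pos2)
  \<comment> \<open>The right-hand sides are chosen to sum to zero over \<open>A\<close>.\<close>
  have "p x * (ln (f x) - ln (p x)) - p x * (ln (sum f A) - ln (sum p A))
      \<le> f x * (sum p A / sum f A) - p x" if "x \<in> A" for x
  proof (cases "p x = 0")
    case True
    then show ?thesis using assms(3)[OF that] P F by simp
  next
    case False
    then have p: "0 < p x" using assms(2)[OF that] by simp
    then have f: "0 < f x" using assms(4) that by simp
    have "p x * (ln (f x) - ln (p x)) - p x * (ln (sum f A) - ln (sum p A))
        = p x * ln (f x * sum p A / (p x * sum f A))"
      using p f P F by (simp add: ln_div ln_mult algebra_simps)
    also have "\<dots> \<le> p x * (f x * sum p A / (p x * sum f A) - 1)"
      using p f P F by (intro mult_left_mono ln_le_minus_one) auto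
    also have "\<dots> = f x * (sum p A / sum f A) - p x"
      using p F by (simp add: field_simps)
    finally show ?thesis .
  qed
  then have "(\<Sum>x\<in>A. p x * (ln (f x) - ln (p x)) - p x * (ln (sum f A) - ln (sum p A)))
      \<le> (\<Sum>x\<in>A. f x * (sum p A / sum f A) - p x)"
    by (rule sum_mono)
  also have "\<dots> = 0"
    using F by (simp only: sum_subtractf flip: sum_distrib_right) simp
  finally show ?thesis
    by (simp add: sum_subtractf flip: sum_distrib_right)
qed

section \<open>Walk counts and cutting of walks\<close>

definition nbrs :: "'a pair_pre_digraph \<Rightarrow> 'a \<Rightarrow> 'a set" where
  "nbrs G x = {y. (x, y) \<in> parcs G}"

fun walks :: "'a pair_pre_digraph \<Rightarrow> nat \<Rightarrow> 'a \<Rightarrow> real" where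
  "walks G 0 x = 1"
| "walks G (Suc n) x = (\<Sum>y\<in>nbrs G x. walks G n y)"

definition total_walks :: "'a pair_pre_digraph \<Rightarrow> nat \<Rightarrow> real" where
  "total_walks G n = (\<Sum>x\<in>pverts G. walks G n x)"

lemma walks_nonneg: "0 \<le> walks G n x"
  by (induction n arbitrary: x) (auto intro: sum_nonneg)

lemma total_walks_nonneg: "0 \<le> total_walks G n"
  by (simp add: total_walks_def sum_nonneg walks_nonneg)

context pair_graph
begin

lemma nbrs_subset: "nbrs G x \<subseteq> pverts G"
  by (auto simp: nbrs_def dest: in_arcsD2)

lemma finite_nbrs: "finite (nbrs G x)"
  using nbrs_subset finite_subset pair_finite_verts by blast

lemma nbrs_sym: "y \<in> nbrs G x \<longleftrightarrow> x \<in> nbrs G y"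
  using pair_sym_arcs by (auto simp: nbrs_def symmetric_def dest: symD)

lemma sum_nbrs_swap:
  "(\<Sum>x\<in>pverts G. \<Sum>y\<in>nbrs G x. f x y) = (\<Sum>y\<in>pverts G. \<Sum>x\<in>nbrs G y. f x y)"
proof -
  have "(\<Sum>x\<in>pverts G. \<Sum>y\<in>nbrs G x. f x y)
      = (\<Sum>x\<in>pverts G. \<Sum>y | y \<in> pverts G \<and> x \<in> nbrs G y. f x y)"
    using nbrs_subset nbrs_sym by (intro sum.cong) auto
  also have "\<dots> = (\<Sum>y\<in>pverts G. \<Sum>x | x \<in> pverts G \<and> x \<in> nbrs G y. f x y)"
    by (rule sum.swap_restrict) (auto simp: pair_finite_verts)
  also have "\<dots> = (\<Sum>y\<in>pverts G. \<Sum>x\<in>nbrs G y. f x y)"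
    using nbrs_subset by (intro sum.cong) auto
  finally show ?thesis .
qed

text \<open>A walk of \<open>p + q\<close> steps is split at one vertex; by symmetry of adjacency a
  step can be moved from one factor to the other.\<close>

lemma sum_walks_mult: "(\<Sum>x\<in>pverts G. walks G p x * walks G q x) = total_walks G (p + q)"
proof (induction q arbitrary: p)
  case 0
  then show ?case by (simp add: total_walks_def)
next
  case (Suc q)
  have "(\<Sum>x\<in>pverts G. walks G p x * walks G (Suc q) x)
      = (\<Sum>x\<in>pverts G. \<Sum>y\<in>nbrs G x. walks G p x * walks G q y)"
    by (simp add: sum_distrib_left)
  also have "\<dots> = (\<Sum>y\<in>pverts G. walks G (Suc p) y * walks G q y)"
    by (subst sum_nbrs_swap) (simp add: sum_distrib_right)
  finally show ?case using Suc[of "Suc p"] by simp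
qed

text \<open>Deleting an edge of a path leaves two shorter paths, and dropping its adjacency
  condition only enlarges the count.\<close>

lemma total_walks_submult: "total_walks G (Suc (p + q)) \<le> total_walks G p * total_walks G q"
proof -
  have "total_walks G (Suc (p + q)) = (\<Sum>x\<in>pverts G. walks G p x * walks G (Suc q) x)"
    by (simp only: sum_walks_mult add_Suc_right)
  also have "\<dots> \<le> (\<Sum>x\<in>pverts G. walks G p x * total_walks G q)"
    unfolding total_walks_def walks.simps
    by (intro sum_mono mult_left_mono sum_mono2 pair_finite_verts nbrs_subset walks_nonneg)
  finally show ?thesis
    by (simp add: total_walks_def sum_distrib_right)
qed

text \<open>\<open>Suc k * Suc v\<close> vertices are cut into \<open>Suc k\<close> blocks of
  \<open>Suc v\<close>; the \<open>- 1\<close> passes from vertices to edges.\<close>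

lemma total_walks_le_power: "total_walks G (Suc k * Suc v - 1) \<le> total_walks G v ^ Suc k"
proof (induction k)
  case (Suc k)
  have "Suc (Suc k) * Suc v - 1 = Suc ((Suc k * Suc v - 1) + v)"
    by simp
  then have "total_walks G (Suc (Suc k) * Suc v - 1)
      \<le> total_walks G (Suc k * Suc v - 1) * total_walks G v"
    using total_walks_submult by metis
  also have "\<dots> \<le> total_walks G v ^ Suc k * total_walks G v"
    using Suc by (intro mult_right_mono total_walks_nonneg)
  finally show ?case by (simp add: mult_ac)
qed simp

lemma walks_pos:
  assumes "y \<in> nbrs G x"
  shows "0 < walks G n x"
  using assms
proof (induction n arbitrary: x y)
  case (Suc n)
  then have "0 < walks G n y" using nbrs_sym by blast
  then show ?case
    using Suc.prems by (auto intro!: sum_pos2[OF finite_nbrs] walks_nonneg)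
qed simp

text \<open>Pinning the last index lets a walk grow by one new value without shifting the other
  indices.\<close>

definition walk_homs :: "nat \<Rightarrow> 'a \<Rightarrow> (nat \<Rightarrow> 'a) set" where
  "walk_homs n x = {f \<in> hom_set (path_graph n) G. f n = x}"

lemma in_walk_homs:
  "f \<in> walk_homs n x \<longleftrightarrow>
     f \<in> {0..n} \<rightarrow>\<^sub>E pverts G \<and> (\<forall>i<n. f (Suc i) \<in> nbrs G (f i)) \<and> f n = x"
proof -
  have "(\<forall>i j. (i, j) \<in> parcs (path_graph n) \<longrightarrow> (f i, f j) \<in> parcs G)
      \<longleftrightarrow> (\<forall>i<n. f (Suc i) \<in> nbrs G (f i))"
  proof safe
    fix i j assume *: "\<forall>i<n. f (Suc i) \<in> nbrs G (f i)" "(i, j) \<in> parcs (path_graph n)"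
    then consider "i < n" "j = Suc i" | "j < n" "i = Suc j"
      by (auto simp: path_graph_def)
    then have "f j \<in> nbrs G (f i)"
      using * nbrs_sym by cases blast+
    then show "(f i, f j) \<in> parcs G"
      by (simp add: nbrs_def)
  qed (auto simp: path_graph_def nbrs_def)
  then show ?thesis
    by (auto simp: walk_homs_def hom_set_def path_graph_def)
qed

lemma finite_hom_set_path: "finite (hom_set (path_graph n) G)"
  by (rule finite_subset[of _ "{0..n} \<rightarrow>\<^sub>E pverts G"])
    (auto simp: hom_set_def path_graph_def intro: finite_PiE pair_finite_verts)

lemma walk_homs_Suc:
  assumes "x \<in> pverts G"
  shows "walk_homs (Suc n) x = (\<Union>y\<in>nbrs G x. (\<lambda>f. f(Suc n := x)) ` walk_homs n y)"
proof (intro equalityI subsetI)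
  fix f assume f: "f \<in> walk_homs (Suc n) x"
  \<comment> \<open>Resetting the dropped index keeps the shorter map extensional.\<close>
  let ?g = "f(Suc n := undefined)"
  have "?g \<in> walk_homs n (f n)"
    using f by (auto simp: in_walk_homs PiE_iff extensional_def)
  moreover have "f n \<in> nbrs G x" "f = ?g(Suc n := x)"
    using f nbrs_sym by (auto simp: in_walk_homs)
  ultimately show "f \<in> (\<Union>y\<in>nbrs G x. (\<lambda>f. f(Suc n := x)) ` walk_homs n y)"
    by blast
next
  fix f assume "f \<in> (\<Union>y\<in>nbrs G x. (\<lambda>f. f(Suc n := x)) ` walk_homs n y)"
  then obtain y g where g: "y \<in> nbrs G x" "g \<in> walk_homs n y" "f = g(Suc n := x)"
    by blast
  have "x \<in> nbrs G y" using g(1) nbrs_sym by blast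
  then show "f \<in> walk_homs (Suc n) x"
    using g assms by (auto simp: in_walk_homs PiE_iff extensional_def less_Suc_eq)
qed

lemma card_walk_homs:
  assumes "x \<in> pverts G"
  shows "real (card (walk_homs n x)) = walks G n x"
  using assms
proof (induction n arbitrary: x)
  case 0
  have "walk_homs 0 x = {\<lambda>i. if i = 0 then x else undefined}"
    using 0 by (auto simp: in_walk_homs PiE_iff extensional_def fun_eq_iff)
  then show ?case by simp
next
  case (Suc n)
  have fin: "finite (walk_homs n y)" for y
    using finite_hom_set_path by (auto simp: walk_homs_def)
  have inj: "inj_on (\<lambda>f. f(Suc n := x)) (walk_homs n y)" for y
  proof (rule inj_onI)
    fix f g assume *: "f \<in> walk_homs n y" "g \<in> walk_homs n y" "f(Suc n := x) = g(Suc n := x)"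
    have "f (Suc n) = undefined" "g (Suc n) = undefined"
      using * by (auto simp: in_walk_homs PiE_iff extensional_def)
    then show "f = g" using *(3) by (metis fun_upd_triv fun_upd_upd)
  qed
  have "card (walk_homs (Suc n) x) = (\<Sum>y\<in>nbrs G x. card ((\<lambda>f. f(Suc n := x)) ` walk_homs n y))"
    unfolding walk_homs_Suc[OF Suc.prems]
  proof (rule card_UN_disjoint)
    show "\<forall>i\<in>nbrs G x. \<forall>j\<in>nbrs G x. i \<noteq> j \<longrightarrow>
        (\<lambda>f. f(Suc n := x)) ` walk_homs n i \<inter> (\<lambda>f. f(Suc n := x)) ` walk_homs n j = {}"
    proof (intro ballI impI, rule ccontr)
      fix i j assume ij: "i \<noteq> j"
        and "(\<lambda>f. f(Suc n := x)) ` walk_homs n i \<inter> (\<lambda>f. f(Suc n := x)) ` walk_homs n j \<noteq> {}"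
      then obtain f g where fg: "f \<in> walk_homs n i" "g \<in> walk_homs n j"
          "f(Suc n := x) = g(Suc n := x)"
        by blast
      have "f n = g n"
        using fun_cong[OF fg(3), of n] by simp
      then show False using fg ij by (simp add: walk_homs_def)
    qed
  qed (auto simp: finite_nbrs fin)
  also have "\<dots> = (\<Sum>y\<in>nbrs G x. card (walk_homs n y))"
    by (simp add: card_image[OF inj])
  finally show ?case
    using Suc.IH nbrs_subset by (auto intro!: sum.cong)
qed

lemma hom_path_graph: "real (hom (path_graph n) G) = total_walks G n"
proof -
  have un: "hom_set (path_graph n) G = (\<Union>x\<in>pverts G. walk_homs n x)"
    by (auto simp: walk_homs_def hom_set_def path_graph_def PiE_iff)
  have "finite (walk_homs n x)" for x
    using finite_hom_set_path by (auto simp: walk_homs_def)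
  then have "hom (path_graph n) G = (\<Sum>x\<in>pverts G. card (walk_homs n x))"
    unfolding hom_def un
    by (intro card_UN_disjoint) (auto simp: pair_finite_verts walk_homs_def)
  then show ?thesis
    by (simp add: total_walks_def card_walk_homs)
qed

end

section \<open>The entropy of a uniformly random walk\<close>

context pair_graph
begin

text \<open>The law of the random walk at time \<open>j\<close>: a walk through \<open>x\<close> is
  a past of \<open>j\<close> steps and a future of \<open>w - j\<close> steps, both counted from
  \<open>x\<close>.\<close>

definition marg :: "nat \<Rightarrow> nat \<Rightarrow> 'a \<Rightarrow> real" where
  "marg w j x = walks G j x * walks G (w - j) x / total_walks G w"

text \<open>The law of two consecutive positions, valid on arcs only; hence sums over
  \<open>y\<close> run over \<open>nbrs G x\<close>.\<close>

definition joint :: "nat \<Rightarrow> nat \<Rightarrow> 'a \<Rightarrow> 'a \<Rightarrow> real" where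
  "joint w j x y = walks G j x * walks G (w - Suc j) y / total_walks G w"

definition marg_ent :: "nat \<Rightarrow> nat \<Rightarrow> real" where
  "marg_ent w j = - (\<Sum>x\<in>pverts G. marg w j x * ln (marg w j x))"

definition joint_ent :: "nat \<Rightarrow> nat \<Rightarrow> real" where
  "joint_ent w j = - (\<Sum>x\<in>pverts G. \<Sum>y\<in>nbrs G x. joint w j x y * ln (joint w j x y))"

definition gain :: "nat \<Rightarrow> nat \<Rightarrow> real" where
  "gain w j = joint_ent w j - (marg_ent w j + marg_ent w (Suc j)) / 2"

text \<open>
  \<open>level w n j\<close> bounds from below the contribution of an \<open>n\<close>-step walk on the indices that ends
  at \<open>j\<close>: the expectation of \<open>ln (walks G n X\<^sub>j)\<close>, shifted by half of the entropy of \<open>X\<^sub>j\<close> so that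
  each step increases it by at least the gain of that step.
\<close>

definition level :: "nat \<Rightarrow> nat \<Rightarrow> nat \<Rightarrow> real" where
  "level w n j = (\<Sum>x\<in>pverts G. marg w j x * ln (walks G n x)) + marg_ent w j / 2"

lemma marg_nonneg: "0 \<le> marg w j x"
  by (simp add: marg_def walks_nonneg total_walks_nonneg)

lemma joint_nonneg: "0 \<le> joint w j x y"
  by (simp add: joint_def walks_nonneg total_walks_nonneg)

lemma sum_joint_right: "j < w \<Longrightarrow> (\<Sum>y\<in>nbrs G x. joint w j x y) = marg w j x"
  by (simp add: joint_def marg_def Suc_diff_Suc flip: sum_distrib_left sum_divide_distrib walks.simps(2))

lemma sum_joint_left: "(\<Sum>x\<in>nbrs G y. joint w j x y) = marg w (Suc j) y"
  by (simp add: joint_def marg_def flip: sum_distrib_right sum_divide_distrib)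

text \<open>The uniformly random walk has the same law when reversed; this symmetry passes to
  entropies and gains.\<close>

lemma marg_rev: "j \<le> w \<Longrightarrow> marg w (w - j) x = marg w j x"
  by (simp add: marg_def)

lemma joint_rev: "j < w \<Longrightarrow> joint w (w - Suc j) x y = joint w j y x"
  by (simp add: joint_def Suc_diff_Suc)

lemma marg_ent_rev: "j \<le> w \<Longrightarrow> marg_ent w (w - j) = marg_ent w j"
  by (simp add: marg_ent_def marg_rev)

lemma joint_ent_rev: "j < w \<Longrightarrow> joint_ent w (w - Suc j) = joint_ent w j"
  unfolding joint_ent_def by (subst sum_nbrs_swap) (simp add: joint_rev)

lemma gain_rev: "j < w \<Longrightarrow> gain w (w - Suc j) = gain w j"
  using marg_ent_rev[of j w] marg_ent_rev[of "Suc j" w]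
  by (simp add: gain_def joint_ent_rev Suc_diff_Suc)

text \<open>Makes logarithms of walk counts meaningful wherever \<open>marg\<close> is nonzero.
  Isolated vertices carry mass only for \<open>w = 0\<close>.\<close>

lemma walks_pos_of_marg:
  assumes "0 < w" "j \<le> w" "marg w j x \<noteq> 0"
  shows "0 < walks G n x"
proof -
  have "nbrs G x \<noteq> {}"
  proof
    assume "nbrs G x = {}"
    then have "walks G (Suc i) x = 0" for i by simp
    then have "walks G i x = 0" if "0 < i" for i using that by (cases i) auto
    moreover have "0 < j \<or> 0 < w - j" using assms by auto
    ultimately show False using assms(3) by (auto simp: marg_def)
  qed
  then show ?thesis using walks_pos by blast
qed

text \<open>For each value \<open>y\<close> of the later position, the log sum inequality is applied
  to the neighbours of \<open>y\<close>, with \<open>joint\<close> as weights.\<close>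

lemma level_up:
  assumes "j < w"
  shows "level w n j + gain w j \<le> level w (Suc n) (Suc j)"
proof -
  have pos: "0 < walks G m x" if "y \<in> nbrs G x" for m x y
    using that walks_pos by blast
  have "(\<Sum>x\<in>pverts G. marg w j x * ln (walks G n x)) + joint_ent w j
      = (\<Sum>x\<in>pverts G. \<Sum>y\<in>nbrs G x. joint w j x y * (ln (walks G n x) - ln (joint w j x y)))"
    by (simp add: joint_ent_def sum_joint_right[OF assms, symmetric] sum_distrib_right
        right_diff_distrib sum_subtractf)
  also have "\<dots> = (\<Sum>y\<in>pverts G. \<Sum>x\<in>nbrs G y. joint w j x y * (ln (walks G n x) - ln (joint w j x y)))"
    by (rule sum_nbrs_swap)
  also have "\<dots> \<le> (\<Sum>y\<in>pverts G. marg w (Suc j) y * (ln (walks G (Suc n) y) - ln (marg w (Suc j) y)))"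
    unfolding sum_joint_left[symmetric] walks.simps
    using nbrs_sym
    by (intro sum_mono log_sum_ineq finite_nbrs joint_nonneg walks_nonneg) (metis pos)
  also have "\<dots> = (\<Sum>y\<in>pverts G. marg w (Suc j) y * ln (walks G (Suc n) y)) + marg_ent w (Suc j)"
    by (simp add: marg_ent_def right_diff_distrib sum_subtractf)
  finally show ?thesis
    unfolding level_def gain_def by argo
qed

lemma level_rev: "j \<le> w \<Longrightarrow> level w n (w - j) = level w n j"
  by (simp add: level_def marg_rev marg_ent_rev)

text \<open>This is \<open>level_up\<close> seen through the reversal of the random walk.\<close>

lemma level_down:
  assumes "j < w"
  shows "level w n (Suc j) + gain w j \<le> level w (Suc n) j"
  using level_up[of "w - Suc j" w n] level_rev[of "Suc j" w n] level_rev[of j w "Suc n"]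
    gain_rev[OF assms] assms
  by (simp add: Suc_diff_Suc)

lemma level_0: "level w 0 j = marg_ent w j / 2"
  by (simp add: level_def)

lemma sum_marg:
  assumes "0 < total_walks G w" "j \<le> w"
  shows "(\<Sum>x\<in>pverts G. marg w j x) = 1"
  using assms by (simp add: marg_def sum_walks_mult flip: sum_divide_distrib)

text \<open>One more log sum inequality, over all vertices, closes an index walk; it contributes the
  second half of the final entropy.\<close>

lemma level_le_ln_total_walks:
  assumes "0 < total_walks G w" "j \<le> w" "0 < w"
  shows "level w n j + marg_ent w j / 2 \<le> ln (total_walks G n)"
proof -
  have "(\<Sum>x\<in>pverts G. marg w j x * (ln (walks G n x) - ln (marg w j x)))
     \<le> sum (marg w j) (pverts G) * (ln (sum (walks G n) (pverts G)) - ln (sum (marg w j) (pverts G)))"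
    using assms walks_pos_of_marg
    by (intro log_sum_ineq pair_finite_verts marg_nonneg walks_nonneg) auto
  also have "\<dots> = ln (total_walks G n)"
    using assms by (simp add: sum_marg total_walks_def)
  finally show ?thesis
    by (simp add: level_def marg_ent_def right_diff_distrib sum_subtractf)
qed

lemma total_walks_pos:
  assumes "0 < total_walks G w" "0 < w"
  shows "0 < total_walks G n"
proof -
  obtain x where x: "x \<in> pverts G" "walks G w x \<noteq> 0"
    using assms(1) by (metis less_irrefl sum.neutral total_walks_def)
  moreover obtain w' where "w = Suc w'" using assms(2) gr0_implies_Suc by blast
  ultimately obtain y where "y \<in> nbrs G x"
    by (metis sum.empty walks.simps(2) ex_in_conv)
  then show ?thesis
    unfolding total_walks_def using x walks_pos walks_nonneg
    by (intro sum_pos2[OF pair_finite_verts]) auto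
qed

text \<open>\<open>joint\<close> is pointwise at most its marginal, so the conditional entropy is
  nonnegative.\<close>

lemma marg_ent_le_joint_ent:
  assumes "j < w"
  shows "marg_ent w j \<le> joint_ent w j"
proof -
  have "(\<Sum>x\<in>pverts G. \<Sum>y\<in>nbrs G x. joint w j x y * ln (joint w j x y))
      \<le> (\<Sum>x\<in>pverts G. \<Sum>y\<in>nbrs G x. joint w j x y * ln (marg w j x))"
  proof (intro sum_mono)
    fix x y assume y: "y \<in> nbrs G x"
    show "joint w j x y * ln (joint w j x y) \<le> joint w j x y * ln (marg w j x)"
    proof (cases "joint w j x y = 0")
      case False
      then have "0 < joint w j x y" using joint_nonneg[of w j x y] by simp
      moreover have "joint w j x y \<le> marg w j x"
        unfolding sum_joint_right[OF assms, symmetric]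
        using y by (intro member_le_sum finite_nbrs joint_nonneg) auto
      ultimately show ?thesis by (intro mult_left_mono) auto
    qed simp
  qed
  also have "\<dots> = (\<Sum>x\<in>pverts G. marg w j x * ln (marg w j x))"
    by (simp add: sum_joint_right[OF assms] flip: sum_distrib_right)
  finally show ?thesis by (simp add: marg_ent_def joint_ent_def)
qed

text \<open>Expectation of the logarithm of the product defining \<open>marg\<close>; points of mass
  zero contribute zero to both sides.\<close>

lemma marg_ent_eq:
  assumes Z: "0 < total_walks G w" and j: "j \<le> w" and w: "0 < w"
  shows "marg_ent w j = ln (total_walks G w) - (\<Sum>x\<in>pverts G. marg w j x * ln (walks G j x))
     - (\<Sum>x\<in>pverts G. marg w j x * ln (walks G (w - j) x))"
proof -
  have "marg w j x * ln (marg w j x) = marg w j x * ln (walks G j x)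
      + marg w j x * ln (walks G (w - j) x) - marg w j x * ln (total_walks G w)" for x
  proof (cases "marg w j x = 0")
    case False
    then have "ln (marg w j x) = ln (walks G j x) + ln (walks G (w - j) x) - ln (total_walks G w)"
      using walks_pos_of_marg[OF w j False] Z by (simp add: marg_def ln_div ln_mult)
    then show ?thesis by (simp only: distrib_left right_diff_distrib)
  qed simp
  then show ?thesis
    using sum_marg[OF Z j]
    by (simp add: marg_ent_def sum.distrib sum_subtractf flip: sum_distrib_right)
qed

lemma joint_ent_eq:
  assumes Z: "0 < total_walks G w" and j: "j < w"
  shows "joint_ent w j = ln (total_walks G w) - (\<Sum>x\<in>pverts G. marg w j x * ln (walks G j x))
     - (\<Sum>x\<in>pverts G. marg w (Suc j) x * ln (walks G (w - Suc j) x))"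
proof -
  have "joint w j x y * ln (joint w j x y) = joint w j x y * ln (walks G j x)
      + joint w j x y * ln (walks G (w - Suc j) y) - joint w j x y * ln (total_walks G w)"
    if "y \<in> nbrs G x" for x y
  proof -
    have "ln (joint w j x y) = ln (walks G j x) + ln (walks G (w - Suc j) y) - ln (total_walks G w)"
      using that nbrs_sym walks_pos Z by (metis joint_def ln_div ln_mult mult_pos_pos less_irrefl)
    then show ?thesis by (simp only: distrib_left right_diff_distrib)
  qed
  then have "joint_ent w j = - ((\<Sum>x\<in>pverts G. \<Sum>y\<in>nbrs G x. joint w j x y * ln (walks G j x))
     + (\<Sum>x\<in>pverts G. \<Sum>y\<in>nbrs G x. joint w j x y * ln (walks G (w - Suc j) y))
     - (\<Sum>x\<in>pverts G. \<Sum>y\<in>nbrs G x. joint w j x y * ln (total_walks G w)))"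
    by (simp add: joint_ent_def sum.distrib sum_subtractf)
  also have "(\<Sum>x\<in>pverts G. \<Sum>y\<in>nbrs G x. joint w j x y * ln (walks G (w - Suc j) y))
      = (\<Sum>y\<in>pverts G. marg w (Suc j) y * ln (walks G (w - Suc j) y))"
    by (subst sum_nbrs_swap) (simp add: sum_joint_left flip: sum_distrib_right)
  also have "(\<Sum>x\<in>pverts G. \<Sum>y\<in>nbrs G x. joint w j x y * ln (total_walks G w)) = ln (total_walks G w)"
    using sum_marg[OF Z, of j] j by (simp add: sum_joint_right flip: sum_distrib_right)
  finally show ?thesis
    using j by (simp add: sum_joint_right flip: sum_distrib_right)
qed

text \<open>Each gain is an increment of \<open>(?f j - ?b j) / 2\<close>, where \<open>?f\<close>
  and \<open>?b\<close> are the expected logarithms of the numbers of pasts and futures, so the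
  gains telescope.\<close>

lemma ln_total_walks_eq:
  assumes Z: "0 < total_walks G w" and w: "0 < w"
  shows "ln (total_walks G w) = (marg_ent w 0 + marg_ent w w) / 2 + (\<Sum>j<w. gain w j)"
proof -
  let ?L = "ln (total_walks G w)"
  let ?f = "\<lambda>j. \<Sum>x\<in>pverts G. marg w j x * ln (walks G j x)"
  let ?b = "\<lambda>j. \<Sum>x\<in>pverts G. marg w j x * ln (walks G (w - j) x)"
  have g: "gain w j = (?b j - ?b (Suc j) + (?f (Suc j) - ?f j)) / 2" if "j < w" for j
    using that joint_ent_eq[OF Z that] marg_ent_eq[OF Z _ w, of j] marg_ent_eq[OF Z _ w, of "Suc j"]
    by (simp add: gain_def field_simps)
  have "(\<Sum>j<w. gain w j) = (\<Sum>j<w. (?f (Suc j) - ?b (Suc j)) / 2 - (?f j - ?b j) / 2)"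
    by (intro sum.cong) (auto simp: g field_simps)
  also have "\<dots> = (?f w - ?b w) / 2 - (?f 0 - ?b 0) / 2"
    by (rule sum_lessThan_telescope)
  finally show ?thesis
    using marg_ent_eq[OF Z _ w, of 0] marg_ent_eq[OF Z _ w, of w] by (simp add: field_simps)
qed

section \<open>Bounds from walks on the indices\<close>

lemma level_straight: "i + j \<le> w \<Longrightarrow> level w n i + (\<Sum>l=i..<i+j. gain w l) \<le> level w (n + j) (i + j)"
proof (induction j)
  case (Suc j)
  then show ?case using level_up[of "i + j" w "n + j"] by simp
qed simp

lemma level_back: "i + j \<le> w \<Longrightarrow> level w n (i + j) + (\<Sum>l=i..<i+j. gain w l) \<le> level w (n + j) i"
proof (induction j arbitrary: n)
  case (Suc j)
  then show ?case using level_down[of "i + j" w n] Suc.IH[of "Suc n"] by simp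
qed simp

lemma level_bounce: "l < w \<Longrightarrow> level w n l + 2 * real m * gain w l \<le> level w (n + 2 * m) l"
proof (induction m)
  case (Suc m)
  then show ?case
    using level_up[of l w "n + 2 * m"] level_down[of l w "Suc (n + 2 * m)"]
    by (simp add: algebra_simps)
qed simp

text \<open>The index walk climbs to \<open>l\<close>, bounces \<open>m\<close> times on the step
  above \<open>l\<close>, and then climbs on to \<open>w\<close>.\<close>

lemma ln_total_walks_bounce:
  assumes Z: "0 < total_walks G w" and l: "l < w"
  shows "ln (total_walks G w) + 2 * real m * gain w l \<le> ln (total_walks G (w + 2 * m))"
proof -
  have "(\<Sum>j<w. gain w j) = (\<Sum>j=0..<l. gain w j) + (\<Sum>j=l..<w. gain w j)"
    using l by (simp add: sum.atLeastLessThan_concat flip: atLeast0LessThan)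
  then have "marg_ent w 0 / 2 + (\<Sum>j<w. gain w j) + 2 * real m * gain w l \<le> level w (w + 2 * m) w"
    using level_straight[of 0 l w 0] level_bounce[OF l, of l m]
      level_straight[of l "w - l" w "l + 2 * m"] l by (simp add: level_0 algebra_simps)
  then show ?thesis
    using level_le_ln_total_walks[OF Z, of w "w + 2 * m"] ln_total_walks_eq[OF Z] l
    by (simp add: field_simps)
qed

text \<open>The walk \<open>0, ..., q, ..., 1\<close> has the odd length \<open>2 * q - 1\<close>
  and uses each step below \<open>q\<close> twice, except step 0, which it uses once.\<close>

lemma half_walk_bound:
  assumes Z: "0 < total_walks G w" and q: "0 < q" "q \<le> w"
  shows "marg_ent w 0 / 2 + (\<Sum>j<q. gain w j) \<le> ln (total_walks G (2 * q - 1)) / 2 + gain w 0"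
proof -
  obtain p where p: "q = Suc p" using q(1) gr0_implies_Suc by blast
  have "(\<Sum>j<q. gain w j) = gain w 0 + (\<Sum>j=1..<q. gain w j)"
    using q(1) by (simp add: sum.atLeast_Suc_lessThan flip: atLeast0LessThan)
  moreover have "level w (2 * q - 1) 1 + marg_ent w 1 / 2 \<le> ln (total_walks G (2 * q - 1))"
    using q by (intro level_le_ln_total_walks[OF Z]) auto
  moreover have "marg_ent w 0 / 2 + (\<Sum>j<q. gain w j) \<le> level w q q"
    using level_straight[of 0 q w 0] q by (simp add: level_0 atLeast0LessThan)
  moreover have "level w q q + (\<Sum>j=1..<q. gain w j) \<le> level w (2 * q - 1) 1"
    using level_back[of 1 p w q] q p by (simp add: mult_2)
  \<comment> \<open>Replaces the entropy at the endpoint 1 by that at 0, at the price of a second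
    gain of step 0.\<close>
  moreover have "marg_ent w 0 \<le> gain w 0 + (marg_ent w 0 + marg_ent w 1) / 2"
    using marg_ent_le_joint_ent[of 0 w] q by (simp add: gain_def)
  ultimately show ?thesis by (simp add: field_simps)
qed

text \<open>\<open>\<beta>\<close> is the largest gain. It bounds each of the
  \<open>w - v - 1\<close> middle gains and the gain of step 0 that \<open>half_walk_bound\<close>
  leaves at each end.\<close>

lemma entropy_bounds:
  assumes Z: "0 < total_walks G w" and "odd v" "v < w"
  obtains \<beta> where
    "ln (total_walks G w) \<le> ln (total_walks G v) + (real w - real v + 1) * \<beta>"
    "\<And>m. ln (total_walks G w) + 2 * real m * \<beta> \<le> ln (total_walks G (w + 2 * m))"
proof
  obtain q where q: "v = 2 * q - 1" "0 < q" "2 * q = Suc v"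
    using \<open>odd v\<close> by (metis add_diff_cancel_right' Suc_eq_plus1 oddE mult_2 add_Suc_right add_Suc zero_less_Suc)
  let ?b = "Max (gain w ` {..<w})"
  have w: "0 < w" using assms by simp
  have fin: "finite (gain w ` {..<w})" "gain w ` {..<w} \<noteq> {}"
    using w by auto
  have le: "gain w l \<le> ?b" if "l < w" for l
    using that fin by simp
  obtain l where "l < w" "?b = gain w l"
    using Max_in[OF fin] by auto
  then show "ln (total_walks G w) + 2 * real m * ?b \<le> ln (total_walks G (w + 2 * m))" for m
    using ln_total_walks_bounce[OF Z] by simp
  have "(\<Sum>j<w. gain w j) = (\<Sum>j<q. gain w j) + (\<Sum>j=q..<w-q. gain w j) + (\<Sum>j=w-q..<w. gain w j)"
    using q assms by (simp add: sum.atLeastLessThan_concat flip: atLeast0LessThan)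
  also have "(\<Sum>j=w-q..<w. gain w j) = (\<Sum>j<q. gain w (w - Suc j))"
    using q assms by (intro sum.reindex_bij_witness[of _ "\<lambda>j. w - Suc j" "\<lambda>j. w - Suc j"]) auto
  also have "\<dots> = (\<Sum>j<q. gain w j)"
    using q assms by (intro sum.cong gain_rev) auto
  finally have "ln (total_walks G w) = marg_ent w 0 + 2 * (\<Sum>j<q. gain w j) + (\<Sum>j=q..<w-q. gain w j)"
    using ln_total_walks_eq[OF Z w] marg_ent_rev[of 0 w] by simp
  moreover have "(\<Sum>j=q..<w-q. gain w j) \<le> real (card {q..<w-q}) * ?b"
    using le by (intro sum_bounded_above) auto
  moreover have "real (card {q..<w-q}) = real w - real v - 1"
    using q assms by simp
  ultimately have "ln (total_walks G w) \<le> marg_ent w 0 + 2 * (\<Sum>j<q. gain w j) + (real w - real v - 1) * ?b"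
    by simp
  moreover have "marg_ent w 0 + 2 * (\<Sum>j<q. gain w j) \<le> ln (total_walks G v) + 2 * ?b"
    using half_walk_bound[OF Z q(2), folded q(1)] q(3) assms le[of 0] w by linarith
  ultimately show "ln (total_walks G w) \<le> ln (total_walks G v) + (real w - real v + 1) * ?b"
    by (simp add: algebra_simps)
qed

section \<open>Elimination of the largest gain\<close>

text \<open>Bouncing keeps the length even, so it never equals the odd number
  \<open>k * (v + 1) - 1\<close>. Length \<open>M * (v + 1)\<close> costs one extra vertex, which is
  negligible for large \<open>M\<close> and leaves
  \<open>(v + 1) * \<beta> \<le> ln (total_walks G v)\<close>.\<close>

lemma ln_total_walks_even_bound:
  assumes Z: "0 < total_walks G w" and "odd v" "even w" "v \<le> w"
  shows "(real v + 1) * ln (total_walks G w) \<le> (real w + 2) * ln (total_walks G v)"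
proof -
  have vw: "v < w" using assms by (cases "v = w") auto
  have pos: "0 < total_walks G n" for n
    using total_walks_pos[OF Z] vw by simp
  let ?A = "ln (total_walks G v)" and ?T = "ln (total_walks G w)" and ?C = "ln (total_walks G 0)"
  obtain \<beta> where \<beta>: "?T \<le> ?A + (real w - real v + 1) * \<beta>"
    "\<And>m. ?T + 2 * real m * \<beta> \<le> ln (total_walks G (w + 2 * m))"
    using entropy_bounds[OF Z \<open>odd v\<close> vw] by blast
  have "(real v + 1) * \<beta> \<le> ?A"
  proof (rule ccontr)
    assume "\<not> (real v + 1) * \<beta> \<le> ?A"
    then obtain n where n: "?C - ?T + real w * \<beta> < real n * ((real v + 1) * \<beta> - ?A)"
      using reals_Archimedean3[of "(real v + 1) * \<beta> - ?A"] by auto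
    \<comment> \<open>The summand \<open>n\<close> gives the contradiction, and \<open>w\<close>
      ensures \<open>w \<le> M * (v + 1)\<close>.\<close>
    define M where "M = n + w"
    have "w \<le> M * (v + 1)"
      by (simp add: M_def)
    moreover have "even (M * (v + 1) - w)"
      using assms by auto
    ultimately obtain m where m: "M * (v + 1) = w + 2 * m"
      by (metis dvdE le_add_diff_inverse)
    have "total_walks G (M * (v + 1)) \<le> total_walks G v ^ M * total_walks G 0"
    proof (cases M)
      case (Suc M')
      then have "total_walks G (M * (v + 1)) \<le> total_walks G (M * (v + 1) - 1) * total_walks G 0"
        using total_walks_submult[of "M * (v + 1) - 1" 0] by simp
      also have "\<dots> \<le> total_walks G v ^ M * total_walks G 0"
        using total_walks_le_power[of M' v] Suc
        by (intro mult_right_mono total_walks_nonneg) simp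
      finally show ?thesis .
    qed simp
    then have "ln (total_walks G (w + 2 * m)) \<le> ln (total_walks G v ^ M * total_walks G 0)"
      using pos m by (intro ln_mono) auto
    also have "\<dots> = real M * ?A + ?C"
      using pos[of v] pos[of 0] by (simp add: ln_mult ln_realpow)
    finally have "?T + 2 * real m * \<beta> \<le> real M * ?A + ?C"
      using \<beta>(2)[of m] by simp
    moreover have "2 * real m = real M * (real v + 1) - real w"
      using arg_cong[OF m, of real] by (simp add: algebra_simps)
    ultimately have "?T + (real M * (real v + 1) - real w) * \<beta> \<le> real M * ?A + ?C"
      by simp
    then have "real M * ((real v + 1) * \<beta> - ?A) \<le> ?C - ?T + real w * \<beta>"
      by (simp add: algebra_simps)
    moreover have "real n * ((real v + 1) * \<beta> - ?A) \<le> real M * ((real v + 1) * \<beta> - ?A)"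
      using \<open>\<not> (real v + 1) * \<beta> \<le> ?A\<close> by (intro mult_right_mono) (auto simp: M_def)
    ultimately show False using n by simp
  qed
  then have "(real w - real v + 1) * ((real v + 1) * \<beta>) \<le> (real w - real v + 1) * ?A"
    using vw by (intro mult_left_mono) auto
  moreover have "(real v + 1) * ?T \<le> (real v + 1) * (?A + (real w - real v + 1) * \<beta>)"
    using \<beta>(1) by (intro mult_left_mono) auto
  ultimately show ?thesis by (simp add: algebra_simps)
qed

text \<open>For odd \<open>w\<close>, bouncing reaches the length \<open>k * (v + 1) - 1\<close>
  exactly, so the walk is cut into \<open>k\<close> blocks with no vertex left over.\<close>

lemma ln_total_walks_odd_bound:
  assumes Z: "0 < total_walks G w" and "odd v" "odd w" "v < w" and k: "w + 1 \<le> k * (v + 1)"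
  shows "(real k * (real v + 1) - real v) * ln (total_walks G w)
    \<le> (real k * real w + 2 * real k - real w - 1) * ln (total_walks G v)"
proof -
  let ?A = "ln (total_walks G v)" and ?T = "ln (total_walks G w)"
  obtain \<beta> where \<beta>: "?T \<le> ?A + (real w - real v + 1) * \<beta>"
    "\<And>m. ?T + 2 * real m * \<beta> \<le> ln (total_walks G (w + 2 * m))"
    using entropy_bounds[OF Z \<open>odd v\<close> \<open>v < w\<close>] by blast
  have "even (k * (v + 1) - (w + 1))" using assms by auto
  then obtain m where "k * (v + 1) - (w + 1) = 2 * m" by blast
  then have m: "k * (v + 1) = w + 1 + 2 * m" using k by simp
  obtain k' where k': "k = Suc k'" using k by (cases k) auto
  have "total_walks G (w + 2 * m) \<le> total_walks G v ^ k"
    using total_walks_le_power[of k' v] m k' by simp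
  then have "ln (total_walks G (w + 2 * m)) \<le> ln (total_walks G v ^ k)"
    using total_walks_pos[OF Z] assms(4) by (intro ln_mono) auto
  then have "ln (total_walks G (w + 2 * m)) \<le> real k * ?A"
    using total_walks_pos[OF Z] assms(4) by (simp add: ln_realpow)
  then have "?T + 2 * real m * \<beta> \<le> real k * ?A"
    using \<beta>(2)[of m] by simp
  \<comment> \<open>The two bounds are scaled so that their terms in \<open>\<beta>\<close> cancel
    when added.\<close>
  then have "(real w - real v + 1) * (?T + 2 * real m * \<beta>) \<le> (real w - real v + 1) * (real k * ?A)"
    using assms(4) by (intro mult_left_mono) auto
  moreover have "2 * real m * ?T \<le> 2 * real m * (?A + (real w - real v + 1) * \<beta>)"
    using \<beta>(1) by (intro mult_left_mono) auto
  ultimately have "(real w - real v + 1 + 2 * real m) * ?T \<le> ((real w - real v + 1) * real k + 2 * real m) * ?A"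
    by (simp add: algebra_simps)
  moreover have "2 * real m = real k * (real v + 1) - (real w + 1)"
    using arg_cong[OF m, of real] by (simp add: algebra_simps)
  then have "real w - real v + 1 + 2 * real m = real k * (real v + 1) - real v"
    "(real w - real v + 1) * real k + 2 * real m = real k * real w + 2 * real k - real w - 1"
    by (simp_all add: algebra_simps)
  ultimately show ?thesis by simp
qed

end

section \<open>Layered graphs\<close>

text \<open>The two permitted sums make the degree \<open>n ^ h j\<close> or
  \<open>n ^ (h j - 1)\<close>, both equal to \<open>n\<close> to the power
  \<open>K + (h j - h i) / 2\<close>. Positive exponents in the second case spread each layer evenly
  over the residues modulo \<open>n\<close>.\<close>

locale layered =
  fixes w n K :: nat and h :: "nat \<Rightarrow> nat"
  assumes n: "0 < n"
    and step: "\<And>i. i < w \<Longrightarrow> h i + h (Suc i) = 2 * K \<or> h i + h (Suc i) = 2 * K + 2 \<and> 0 < h i \<and> 0 < h (Suc i)"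
begin

definition adjacent :: "nat \<Rightarrow> nat \<Rightarrow> bool" where
  "adjacent i j \<longleftrightarrow> i \<le> w \<and> j \<le> w \<and> (j = Suc i \<or> i = Suc j)"

text \<open>Adjacent layers span a complete bipartite graph if their exponents sum to
  \<open>2 * K\<close>, and otherwise \<open>n\<close> disjoint ones, one for each residue.\<close>

definition arc :: "nat \<times> nat \<Rightarrow> nat \<times> nat \<Rightarrow> bool" where
  "arc a b \<longleftrightarrow> adjacent (fst a) (fst b) \<and> snd a < n ^ h (fst a) \<and> snd b < n ^ h (fst b) \<and>
     (h (fst a) + h (fst b) = 2 * K \<or> snd a mod n = snd b mod n)"

definition graph :: "(nat \<times> nat) pair_pre_digraph" where
  "graph = \<lparr> pverts = (SIGMA i:{..w}. {..<n ^ h i}), parcs = {(a, b). arc a b} \<rparr>"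

lemma adjacent_step:
  assumes "adjacent i j"
  shows "h i + h j = 2 * K \<or> h i + h j = 2 * K + 2 \<and> 0 < h i \<and> 0 < h j"
  using assms step[of i] step[of j] by (auto simp: adjacent_def add.commute)

lemma pair_graph_graph: "pair_graph graph"
proof -
  have fin: "finite (SIGMA i:{..w}. {..<n ^ h i})" by auto
  have sub: "{(a, b). arc a b} \<subseteq> (SIGMA i:{..w}. {..<n ^ h i}) \<times> (SIGMA i:{..w}. {..<n ^ h i})"
    by (auto simp: arc_def adjacent_def)
  have "finite {(a, b). arc a b}"
    by (rule finite_subset[OF sub]) (use fin in auto)
  then show ?thesis
    by unfold_locales
      (auto simp: graph_def arc_def symmetric_def adjacent_def add.commute intro!: symI)
qed

lemma card_mod_eq: "r < n \<Longrightarrow> card {y. y < n * t \<and> y mod n = r} = t"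
proof -
  assume r: "r < n"
  have "{y. y < n * t \<and> y mod n = r} = (\<lambda>q. q * n + r) ` {..<t}"
  proof (intro equalityI subsetI)
    fix y assume "y \<in> {y. y < n * t \<and> y mod n = r}"
    then have "y = (y div n) * n + r" "y div n < t"
      using n by (auto simp: less_mult_imp_div_less mult.commute)
    then show "y \<in> (\<lambda>q. q * n + r) ` {..<t}" by blast
  next
    fix y assume "y \<in> (\<lambda>q. q * n + r) ` {..<t}"
    then obtain q where q: "q < t" "y = q * n + r" by auto
    have "q * n + r < Suc q * n" using r by simp
    also have "\<dots> \<le> t * n" using q by (intro mult_right_mono) auto
    finally show "y \<in> {y. y < n * t \<and> y mod n = r}"
      using q r by (simp add: mult.commute)
  qed
  moreover have "inj_on (\<lambda>q. q * n + r) {..<t}"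
    using n by (auto simp: inj_on_def)
  ultimately show ?thesis by (simp add: card_image)
qed

lemma card_layer_nbrs:
  assumes a: "adjacent i j" "x < n ^ h i"
  shows "real (card {y. arc (i, x) (j, y)}) = real n powr (real K + (real (h j) - real (h i)) / 2)"
proof (cases "h i + h j = 2 * K")
  case True
  then have "{y. arc (i, x) (j, y)} = {..<n ^ h j}"
    using a by (auto simp: arc_def)
  moreover have "real K + (real (h j) - real (h i)) / 2 = real (h j)"
    using arg_cong[OF True, of real] by (simp add: field_simps)
  ultimately show ?thesis using n by (simp add: powr_realpow)
next
  case False
  then have s: "h i + h j = 2 * K + 2" "0 < h j"
    using adjacent_step[OF a(1)] by auto
  have "n ^ h j = n * n ^ (h j - 1)"
    using s(2) by (cases "h j") auto
  then have "{y. arc (i, x) (j, y)} = {y. y < n * n ^ (h j - 1) \<and> y mod n = x mod n}"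
    using a False by (auto simp: arc_def)
  moreover have "real K + (real (h j) - real (h i)) / 2 = real (h j - 1)"
    using arg_cong[OF s(1), of real] s(2) by (simp add: of_nat_diff field_simps)
  ultimately show ?thesis using n card_mod_eq[of "x mod n"] by (simp add: powr_realpow)
qed

lemma finite_layer_nbrs: "finite {y. arc (i, x) (j, y)}"
  by (rule finite_subset[of _ "{..<n ^ h j}"]) (auto simp: arc_def)

lemma nbrs_graph: "nbrs graph (i, x) = (SIGMA j:{j. adjacent i j}. {y. arc (i, x) (j, y)})"
  by (auto simp: nbrs_def graph_def arc_def)

lemma finite_adjacent: "finite {j. adjacent i j}"
  by (rule finite_subset[of _ "{..w}"]) (auto simp: adjacent_def)

lemma walks_Suc_graph:
  "walks graph (Suc m) (i, x) = (\<Sum>j | adjacent i j. \<Sum>y | arc (i, x) (j, y). walks graph m (j, y))"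
  unfolding walks.simps nbrs_graph
  by (subst sum.Sigma) (auto simp: finite_layer_nbrs finite_adjacent)

lemma card_adjacent_le: "card {j. adjacent i j} \<le> 2"
proof -
  have "card {j. adjacent i j} \<le> card {Suc i, i - 1}"
    by (intro card_mono) (auto simp: adjacent_def)
  also have "\<dots> \<le> 2" by (simp add: card_insert_if)
  finally show ?thesis .
qed

text \<open>Degrees telescope along a sequence of layers, so only its ends enter the exponent.
  \<open>2 ^ m\<close> bounds the number of sequences, and \<open>c\<close> the exponents of the end
  layers that distance and parity allow.\<close>

lemma walks_le:
  fixes c :: real
  assumes "i \<le> w" "x < n ^ h i"
    and "\<And>j. j \<le> w \<Longrightarrow> j \<le> i + m \<Longrightarrow> i \<le> j + m \<Longrightarrow> even (i + j + m) \<Longrightarrow> real (h j) \<le> c"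
  shows "walks graph m (i, x) \<le> 2 ^ m * real n powr (real K * real m + (c - real (h i)) / 2)"
  using assms
proof (induction m arbitrary: i x)
  case 0
  then have "real (h i) \<le> c" by auto
  then have "1 \<le> real n powr ((c - real (h i)) / 2)"
    using n by (intro ge_one_powr_ge_zero) auto
  then show ?case by simp
next
  case (Suc m)
  let ?B = "2 ^ m * real n powr (real K * real (Suc m) + (c - real (h i)) / 2)"
  have "(\<Sum>y | arc (i, x) (j, y). walks graph m (j, y)) \<le> ?B" if j: "adjacent i j" for j
  proof -
    have "walks graph m (j, y) \<le> 2 ^ m * real n powr (real K * real m + (c - real (h j)) / 2)"
      if "arc (i, x) (j, y)" for y
    proof (rule Suc.IH)
      show "j \<le> w" "y < n ^ h j" using that j by (auto simp: arc_def adjacent_def)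
      fix l assume "l \<le> w" "l \<le> j + m" "j \<le> l + m" "even (j + l + m)"
      then show "real (h l) \<le> c"
        using j by (intro Suc.prems(3)) (auto simp: adjacent_def)
    qed
    then have "(\<Sum>y | arc (i, x) (j, y). walks graph m (j, y))
        \<le> real (card {y. arc (i, x) (j, y)}) * (2 ^ m * real n powr (real K * real m + (c - real (h j)) / 2))"
      by (intro sum_bounded_above) auto
    also have "\<dots> = ?B"
    proof -
      have "real K * real (Suc m) + (c - real (h i)) / 2
          = (real K + (real (h j) - real (h i)) / 2) + (real K * real m + (c - real (h j)) / 2)"
        by (simp add: field_simps)
      then show ?thesis
        unfolding card_layer_nbrs[OF j Suc.prems(2)] by (simp only: powr_add mult_ac)
    qed
    finally show ?thesis .
  qed
  then have "walks graph (Suc m) (i, x) \<le> real (card {j. adjacent i j}) * ?B"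
    unfolding walks_Suc_graph by (intro sum_bounded_above) auto
  also have "\<dots> \<le> 2 * ?B"
    using card_adjacent_le[of i] by (intro mult_right_mono) auto
  finally show ?case by simp
qed

text \<open>Only the walks that climb one layer at each step are counted.\<close>

lemma walks_ge:
  assumes "i + m \<le> w" "x < n ^ h i"
  shows "real n powr (real K * real m + (real (h (i + m)) - real (h i)) / 2) \<le> walks graph m (i, x)"
  using assms
proof (induction m arbitrary: i x)
  case 0
  then show ?case using n by simp
next
  case (Suc m)
  have a: "adjacent i (Suc i)" using Suc.prems by (simp add: adjacent_def)
  have "real n powr (real K * real m + (real (h (Suc i + m)) - real (h (Suc i))) / 2)
      \<le> walks graph m (Suc i, y)" if "arc (i, x) (Suc i, y)" for y
    using that Suc.prems by (intro Suc.IH) (auto simp: arc_def)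
  then have "real (card {y. arc (i, x) (Suc i, y)})
      * real n powr (real K * real m + (real (h (Suc i + m)) - real (h (Suc i))) / 2)
      \<le> (\<Sum>y | arc (i, x) (Suc i, y). walks graph m (Suc i, y))"
    by (intro sum_bounded_below) auto
  also have "\<dots> \<le> walks graph (Suc m) (i, x)"
    unfolding walks_Suc_graph using a
    by (intro member_le_sum[of "Suc i" "{j. adjacent i j}"] sum_nonneg walks_nonneg finite_adjacent) auto
  finally have *: "real (card {y. arc (i, x) (Suc i, y)})
      * real n powr (real K * real m + (real (h (Suc i + m)) - real (h (Suc i))) / 2)
      \<le> walks graph (Suc m) (i, x)" .
  show ?case
  proof -
    have "real K * real (Suc m) + (real (h (i + Suc m)) - real (h i)) / 2
        = (real K + (real (h (Suc i)) - real (h i)) / 2)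
          + (real K * real m + (real (h (Suc i + m)) - real (h (Suc i))) / 2)"
      by (simp add: field_simps)
    then show ?thesis
      using * unfolding card_layer_nbrs[OF a Suc.prems(2)] by (simp only: powr_add)
  qed
qed

lemma total_walks_graph: "total_walks graph m = (\<Sum>i\<le>w. \<Sum>x<n ^ h i. walks graph m (i, x))"
  by (simp add: total_walks_def graph_def sum.Sigma)

lemma total_walks_le:
  assumes "\<And>i j. i \<le> w \<Longrightarrow> j \<le> w \<Longrightarrow> j \<le> i + m \<Longrightarrow> i \<le> j + m \<Longrightarrow> even (i + j + m) \<Longrightarrow> h i + h j \<le> B"
  shows "total_walks graph m \<le> (real w + 1) * 2 ^ m * real n powr (real K * real m + real B / 2)"
proof -
  have "(\<Sum>x<n ^ h i. walks graph m (i, x)) \<le> 2 ^ m * real n powr (real K * real m + real B / 2)"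
    if i: "i \<le> w" for i
  proof -
    \<comment> \<open>\<open>c\<close> is taken as \<open>B - h i\<close>; multiplying by the
      \<open>n ^ h i\<close> starting vertices then removes \<open>h i\<close> from the
      exponent.\<close>
    have "walks graph m (i, x)
        \<le> 2 ^ m * real n powr (real K * real m + ((real B - real (h i)) - real (h i)) / 2)"
      if "x < n ^ h i" for x
    proof (rule walks_le[OF i that])
      fix j assume "j \<le> w" "j \<le> i + m" "i \<le> j + m" "even (i + j + m)"
      then have "h i + h j \<le> B" using assms i by blast
      then show "real (h j) \<le> real B - real (h i)" by linarith
    qed
    then have "(\<Sum>x<n ^ h i. walks graph m (i, x)) \<le> real (card {..<n ^ h i})
       * (2 ^ m * real n powr (real K * real m + ((real B - real (h i)) - real (h i)) / 2))"
      by (intro sum_bounded_above) auto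
    also have "\<dots> = 2 ^ m * (real n powr real (h i) * real n powr (real K * real m + ((real B - real (h i)) - real (h i)) / 2))"
      using n by (simp add: powr_realpow)
    also have "\<dots> = 2 ^ m * real n powr (real K * real m + real B / 2)"
      unfolding powr_add[symmetric] by (simp add: field_simps)
    finally show ?thesis .
  qed
  then have "total_walks graph m \<le> real (card {..w}) * (2 ^ m * real n powr (real K * real m + real B / 2))"
    unfolding total_walks_graph by (intro sum_bounded_above) auto
  then show ?thesis by (simp add: mult_ac add.commute)
qed

lemma total_walks_ge:
  "real n powr (real K * real w + (real (h 0) + real (h w)) / 2) \<le> total_walks graph w"
proof -
  have "real (card {..<n ^ h 0}) * real n powr (real K * real w + (real (h w) - real (h 0)) / 2)
      \<le> (\<Sum>x<n ^ h 0. walks graph w (0, x))"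
    using walks_ge[of 0 w] by (intro sum_bounded_below) auto
  also have "\<dots> \<le> total_walks graph w"
    unfolding total_walks_graph
    by (intro member_le_sum[of 0 "{..w}"] sum_nonneg walks_nonneg) auto
  moreover have "real (card {..<n ^ h 0}) = real n powr real (h 0)"
    using n by (simp add: powr_realpow)
  moreover have "real n powr real (h 0) * real n powr (real K * real w + (real (h w) - real (h 0)) / 2)
      = real n powr (real K * real w + (real (h 0) + real (h w)) / 2)"
    unfolding powr_add[symmetric] by (simp add: field_simps)
  ultimately show ?thesis by simp
qed

end

text \<open>The constant does not depend on \<open>n\<close>, so a larger exponent on the left would
  win for large \<open>n\<close>.\<close>

lemma exponent_le_of_powr_le:
  fixes X Y C :: real
  assumes "\<And>n::nat. 0 < n \<Longrightarrow> real n powr X \<le> C * real n powr Y"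
  shows "X \<le> Y"
proof (rule ccontr)
  assume "\<not> X \<le> Y"
  then have XY: "0 < X - Y" by simp
  have "0 < C" using assms[of 1] by simp
  obtain n :: nat where n: "C powr (1 / (X - Y)) < real n"
    using reals_Archimedean2 by blast
  have n0: "0 < real n" using n \<open>0 < C\<close> by (smt (verit) powr_gt_zero)
  have "C = (C powr (1 / (X - Y))) powr (X - Y)"
    using XY \<open>0 < C\<close> by (simp add: powr_powr)
  also have "\<dots> < real n powr (X - Y)"
    using n XY by (intro powr_less_mono2) auto
  also have "\<dots> = real n powr X / real n powr Y"
    by (simp add: powr_diff)
  also have "\<dots> \<le> C"
    using assms[of n] n0 by (simp add: field_simps)
  finally show False by simp
qed

lemma hom_dominates_path_bound:
  assumes dom: "hom_dominates (path_graph v) (path_graph w) c" and c: "0 \<le> c"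
    and step: "\<And>i. i < w \<Longrightarrow> h i + h (Suc i) = 2 * K \<or> h i + h (Suc i) = 2 * K + 2 \<and> 0 < h i \<and> 0 < h (Suc i)"
    and ends: "\<And>i j. i \<le> w \<Longrightarrow> j \<le> w \<Longrightarrow> j \<le> i + v \<Longrightarrow> i \<le> j + v \<Longrightarrow> even (i + j + v) \<Longrightarrow> h i + h j \<le> B"
  shows "c * (real K * real w + (real (h 0) + real (h w)) / 2) \<le> real K * real v + real B / 2"
proof -
  let ?X = "real K * real w + (real (h 0) + real (h w)) / 2"
  have "real n powr (c * ?X) \<le> ((real w + 1) * 2 ^ v) * real n powr (real K * real v + real B / 2)"
    if n: "0 < n" for n
  proof -
    interpret layered w n K h
      using n step by unfold_locales auto
    have "real n powr (c * ?X) = (real n powr ?X) powr c"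
      by (simp add: powr_powr mult.commute)
    also have "\<dots> \<le> total_walks graph w powr c"
      using c by (intro powr_mono2 total_walks_ge) auto
    also have "\<dots> \<le> total_walks graph v"
      using hom_dominatesD[OF pair_graph_path_graph pair_graph_path_graph dom pair_graph_graph]
      by (simp add: pair_graph.hom_path_graph[OF pair_graph_graph])
    also have "\<dots> \<le> ((real w + 1) * 2 ^ v) * real n powr (real K * real v + real B / 2)"
      using total_walks_le[OF ends] by simp
    finally show ?thesis .
  qed
  then show ?thesis by (rule exponent_le_of_powr_le)
qed

lemma hom_dominates_path_even_bound:
  assumes dom: "hom_dominates (path_graph v) (path_graph w) c" and "0 \<le> c" "odd v" "even w"
  shows "c * (real w + 2) \<le> real v + 1"
proof -
  \<comment> \<open>Layers alternate between \<open>n ^ 2\<close> vertices and one. Odd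
    \<open>v\<close> joins opposite parities, with sum 2, while both ends 0 and \<open>w\<close> are
    large.\<close>
  have "c * (real 1 * real w + (real 2 + real 2) / 2) \<le> real 1 * real v + real 2 / 2"
    using hom_dominates_path_bound[OF dom, of "\<lambda>i. if even i then 2 else 0" 1 2] assms
    by auto
  then show ?thesis by simp
qed

text \<open>Here \<open>K\<close> is one less than the optimal \<open>k\<close>. Both end layers get
  exponent \<open>2 * K + 1\<close>, while layers joined by \<open>v\<close> steps have sum at most
  \<open>2 * K + 2\<close>.\<close>

lemma hom_dominates_path_odd_bound:
  assumes dom: "hom_dominates (path_graph v) (path_graph w) c" and "0 \<le> c" "odd v" "odd w"
  defines "K \<equiv> w div (v + 1)"
  shows "c * (real K * real w + 2 * real K + 1) \<le> real K * (real v + 1) + 1"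
proof -
  \<comment> \<open>The truncated subtraction keeps the even layers at exponent at least \<open>1\<close>. Each drop by \<open>2\<close> of an
    even layer \<open>u\<close> is followed by a rise by \<open>2\<close> of the odd layer \<open>u + v\<close>, so that sums of adjacent
    layers alternate between \<open>2 K\<close> and \<open>2 K + 2\<close>.\<close>
  define h where "h i = (if even i then 2 * (K - (i + v - 1) div (v + 1)) + 1
    else 2 * ((i - 1) div (v + 1)) + 1)" for i
  have v: "0 < v" using \<open>odd v\<close> by (cases v) auto
  have S_le: "(j - 1) div (v + 1) \<le> K" if "j \<le> w" for j
    unfolding K_def using that by (intro div_le_mono) auto
  have hh: "h i + h j = 2 * (K - (i + v - 1) div (v + 1)) + 2 * ((j - 1) div (v + 1)) + 2"
    if "even i" "odd j" for i j
    using that by (simp add: h_def)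
  \<comment> \<open>The odd layer \<open>j\<close> has risen at most as often as the drops counted
    at \<open>i\<close>; \<open>S_le\<close> covers the case where the subtraction
    truncates.\<close>
  have upper: "h i + h j \<le> 2 * K + 2"
    if "even i" "odd j" "j \<le> w" "j \<le> i + v" for i j
  proof -
    have "(j - 1) div (v + 1) \<le> (i + v - 1) div (v + 1)"
      using that by (intro div_le_mono) auto
    then show ?thesis using hh[OF that(1,2)] S_le[OF that(3)] by linarith
  qed
  have lower: "2 * K \<le> h i + h j" if "even i" "odd j" "i \<le> j + 1" for i j
  proof (cases "i = 0")
    case True
    then show ?thesis using hh[OF that(1,2)] v by simp
  next
    case False
    \<comment> \<open>Since \<open>i \<ge> 2\<close>, a full period splits off, so the drops exceed
      the rises by at most one.\<close>
    then have "i + v - 1 = (i - 2) + (v + 1)" using that by auto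
    then have "(i + v - 1) div (v + 1) = (i - 2) div (v + 1) + 1"
      by (simp only: div_add_self2)
    moreover have "(i - 2) div (v + 1) \<le> (j - 1) div (v + 1)"
      using that by (intro div_le_mono) auto
    ultimately show ?thesis using hh[OF that(1,2)] by linarith
  qed
  have par: "even (h i + h j)" for i j by (simp add: h_def)
  have pos: "0 < h i" for i by (simp add: h_def)
  have "c * (real K * real w + (real (h 0) + real (h w)) / 2) \<le> real K * real v + real (2 * K + 2) / 2"
  proof (rule hom_dominates_path_bound[OF dom \<open>0 \<le> c\<close>])
    fix i assume i: "i < w"
    have "2 * K \<le> h i + h (Suc i)" "h i + h (Suc i) \<le> 2 * K + 2"
      using lower[of i "Suc i"] lower[of "Suc i" i] upper[of i "Suc i"] upper[of "Suc i" i] i v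
      by (auto simp: add.commute)
    then show "h i + h (Suc i) = 2 * K \<or> h i + h (Suc i) = 2 * K + 2 \<and> 0 < h i \<and> 0 < h (Suc i)"
      using par[of i "Suc i"] pos by presburger
  next
    fix i j assume "i \<le> w" "j \<le> w" "j \<le> i + v" "i \<le> j + v" "even (i + j + v)"
    then show "h i + h j \<le> 2 * K + 2"
      using upper[of i j] upper[of j i] \<open>odd v\<close> by (cases "even i") (auto simp: add.commute)
  qed
  moreover have "h 0 = 2 * K + 1" using v by (simp add: h_def)
  moreover have "h w = 2 * K + 1"
  proof -
    \<comment> \<open>\<open>v + 1\<close> is even and \<open>w\<close> odd, so \<open>w - 1\<close>
      lies in the same block as \<open>w\<close>.\<close>
    have "w mod (v + 1) \<noteq> 0"
      using \<open>odd v\<close> \<open>odd w\<close> by (metis dvd_trans even_Suc Suc_eq_plus1 mod_eq_0_iff_dvd)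
    then have "(w - 1) div (v + 1) = K"
      unfolding K_def
      by (metis Suc_pred' \<open>odd w\<close> div_Suc odd_pos Suc_eq_plus1)
    then show ?thesis using \<open>odd w\<close> by (simp add: h_def)
  qed
  ultimately have "c * (real K * real w + (2 * real K + 1)) \<le> real K * real v + (real K + 1)"
    by (simp add: add_divide_distrib add.commute)
  then show ?thesis by (simp add: algebra_simps)
qed

section \<open>The exponents\<close>

lemma hom_dominates_pathI:
  assumes "0 < w" and "0 \<le> a" "0 < b"
    and "\<And>G :: nat pair_pre_digraph. pair_graph G \<Longrightarrow> 0 < total_walks G w \<Longrightarrow>
      a * ln (total_walks G w) \<le> b * ln (total_walks G v)"
  shows "hom_dominates (path_graph v) (path_graph w) (a / b)"
  unfolding hom_dominates_def
proof (intro allI impI)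
  fix G :: "nat pair_pre_digraph"
  assume G: "pair_graph G"
  interpret pair_graph G by fact
  show "real (hom (path_graph w) G) powr (a / b) \<le> real (hom (path_graph v) G)"
  proof (cases "0 < total_walks G w")
    case True
    then have v: "0 < total_walks G v"
      using total_walks_pos assms(1) by blast
    have "a / b * ln (total_walks G w) \<le> ln (total_walks G v)"
      using assms(4)[OF G True] assms(3) by (simp add: field_simps)
    then have "exp (a / b * ln (total_walks G w)) \<le> exp (ln (total_walks G v))"
      by simp
    then show ?thesis
      using True v by (simp add: hom_path_graph powr_def)
  next
    \<comment> \<open>Without walks of \<open>w\<close> steps the power is
      \<open>0 powr (a / b) = 0\<close>.\<close>
    case False
    then have "total_walks G w = 0"
      using total_walks_nonneg[of G w] by simp
    then show ?thesis by (simp add: hom_path_graph total_walks_nonneg)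
  qed
qed

text \<open>A negative \<open>c\<close> is below \<open>a / b\<close> anyway, so the layered graphs
  are needed only for \<open>0 \<le> c\<close>, where \<open>powr\<close> is monotone in its
  base.\<close>

lemma is_HDEI:
  assumes "hom_dominates F\<^sub>1 F\<^sub>2 (a / b)" "0 \<le> a" "0 < b"
    and "\<And>c. hom_dominates F\<^sub>1 F\<^sub>2 c \<Longrightarrow> 0 \<le> c \<Longrightarrow> c * b \<le> a"
  shows "is_HDE F\<^sub>1 F\<^sub>2 (a / b)"
  unfolding is_HDE_def
proof (intro conjI allI impI)
  fix c assume c: "hom_dominates F\<^sub>1 F\<^sub>2 c"
  show "c \<le> a / b"
  proof (cases "0 \<le> c")
    case True
    then show ?thesis using assms(3,4) c by (simp add: pos_le_divide_eq)
  next
    case False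
    then show ?thesis using assms(2,3) by (meson divide_nonneg_pos le_cases order_trans)
  qed
qed fact

lemma is_HDE_path_even:
  assumes "odd v" "v \<le> w" "even w"
  shows "is_HDE (path_graph v) (path_graph w) ((real v + 1) / (real w + 2))"
proof (rule is_HDEI)
  have "0 < w" using assms by (cases w) auto
  then show "hom_dominates (path_graph v) (path_graph w) ((real v + 1) / (real w + 2))"
    using assms by (intro hom_dominates_pathI) (auto intro: pair_graph.ln_total_walks_even_bound)
qed (use assms hom_dominates_path_even_bound in auto)

lemma is_HDE_path_odd:
  assumes "odd v" "v \<le> w" "odd w" and k: "k = w div (v + 1) + 1"
  shows "is_HDE (path_graph v) (path_graph w)
    ((real k * (real v + 1) - real v) / (real k * real w + 2 * real k - real w - 1))"
proof -
  define K where "K = w div (v + 1)"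
  have num: "real k * (real v + 1) - real v = real K * (real v + 1) + 1"
    and den: "real k * real w + 2 * real k - real w - 1 = real K * real w + 2 * real K + 1"
    by (simp_all add: k K_def algebra_simps)
  have "w < (w div (v + 1) + 1) * (v + 1)"
    using dividend_less_div_times[of "v + 1" w] by simp
  then have wk: "w + 1 \<le> k * (v + 1)" by (simp add: k)
  have w: "0 < w" using \<open>odd w\<close> by (cases w) auto
  show ?thesis
  proof (rule is_HDEI)
    show "hom_dominates (path_graph v) (path_graph w)
      ((real k * (real v + 1) - real v) / (real k * real w + 2 * real k - real w - 1))"
    proof (rule hom_dominates_pathI[OF w])
      fix G :: "nat pair_pre_digraph"
      assume G: "pair_graph G" "0 < total_walks G w"
      show "(real k * (real v + 1) - real v) * ln (total_walks G w)
        \<le> (real k * real w + 2 * real k - real w - 1) * ln (total_walks G v)"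
      \<comment> \<open>The entropy bounds assume \<open>v < w\<close>. If \<open>v = w\<close>,
        then \<open>k = 1\<close> and both coefficients are 1.\<close>
      proof (cases "v = w")
        case True
        then show ?thesis by (simp add: k)
      next
        case False
        then show ?thesis
          using pair_graph.ln_total_walks_odd_bound[OF G assms(1,3) _ wk] assms(2) by simp
      qed
    qed (simp_all add: num den add_nonneg_pos)
  next
    fix c assume "hom_dominates (path_graph v) (path_graph w) c" "0 \<le> c"
    then show "c * (real k * real w + 2 * real k - real w - 1) \<le> real k * (real v + 1) - real v"
      unfolding num den K_def using hom_dominates_path_odd_bound assms by blast
  qed (simp_all add: num den add_nonneg_pos)
qed

text \<open>The minimum over all integers exists because the factor \<open>int v + 1\<close> is
  positive, which bounds the admissible \<open>k\<close> from below.\<close>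

lemma Least_mult_ge_eq:
  fixes v w :: nat
  shows "(LEAST k :: int. k * (int v + 1) \<ge> int w + 1) = int (w div (v + 1) + 1)"
proof (rule Least_equality)
  have "w < (w div (v + 1) + 1) * (v + 1)"
    using dividend_less_div_times[of "v + 1" w] by simp
  then have "int (w + 1) \<le> int ((w div (v + 1) + 1) * (v + 1))"
    by linarith
  then show "int w + 1 \<le> int (w div (v + 1) + 1) * (int v + 1)"
    by (simp only: of_nat_mult of_nat_add of_nat_1)
next
  fix k :: int
  assume k: "int w + 1 \<le> k * (int v + 1)"
  have "int (w div (v + 1)) * (int v + 1) \<le> int w"
    using div_times_less_eq_dividend[of w "v + 1"]
    by (metis of_nat_mult of_nat_add of_nat_1 of_nat_le_iff)
  then have "int (w div (v + 1)) * (int v + 1) < k * (int v + 1)"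
    using k by linarith
  then show "int (w div (v + 1) + 1) \<le> k"
    by (simp add: mult_less_cancel_right)
qed

theorem theorem6p1:
  fixes v w :: nat
  assumes "0 < v" and "v \<le> w" and "odd v"
  shows "(even w \<longrightarrow>
      is_HDE (path_graph v) (path_graph w) ((real v + 1) / (real w + 2))) \<and>
    (odd w \<longrightarrow>
      (let k = real_of_int (LEAST k :: int. k * (int v + 1) \<ge> int w + 1) in
        is_HDE (path_graph v) (path_graph w)
          ((k * (real v + 1) - real v) / (k * real w + 2 * k - real w - 1))))"
  unfolding Least_mult_ge_eq Let_def of_int_of_nat_eq
  using is_HDE_path_even is_HDE_path_odd assms by blast

end
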